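(* For all integers $k \geq 3$ and $m \geq 3$, $$R(K_{3,m},K_{3,m}) + 2(k-2) \leq gr_k(K_3 : K_{3,m}) \leq \max\{6m-2,\ R(K_{3,m},K_{3,m})\} + 2(k-2).$$
   Context: $K_{3,m}$ is the complete bipartite graph with parts of sizes $3$ and $m$. $R(H,H)$ is the least $n$ such that every red/blue coloring of the edges of $K_n$ contains a monochromatic copy of $H$. A rainbow triangle is a triangle whose three edges have three distinct colors. $gr_k(K_3 : H)$ is the minimum integer $n$ such that every $k$-coloring of the edges of $K_n$ (using all $k$ colors) contains either a rainbow triangle or a monochromatic copy of $H$.
   Formalization: Read literally, gr_k is at most 1, since K_1 has no coloring using all k colors, so the lower bound fails; here gr_k(K_3 : H) is the least n such that for every N ≥ n each coloring of K_N using all k colors contains a rainbow triangle or a monochromatic H. *)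

theory Defs
  imports Main "HOL-Library.FuncSet" "HOL-Library.Ramsey"
begin

type_synonym 'a sgraph = "'a set \<times> 'a set set"

definition complete_bipartite :: "nat \<Rightarrow> nat \<Rightarrow> (nat + nat) sgraph" where
  "complete_bipartite a b =
     ({..<a} <+> {..<b}, {{Inl i, Inr j} | i j. i < a \<and> j < b})"

(* An edge coloring of K_n is a function c on the two-element subsets of {..<n};
   its values outside nsets {..<n} 2 are irrelevant. *)

definition has_mono_copy :: "'a sgraph \<Rightarrow> nat \<Rightarrow> (nat set \<Rightarrow> nat) \<Rightarrow> bool" where
  "has_mono_copy H n c \<longleftrightarrow>
     (\<exists>f i. inj_on f (fst H) \<and> f ` fst H \<subseteq> {..<n} \<and> (\<forall>e\<in>snd H. c (f ` e) = i))"

definition has_rainbow_triangle :: "nat \<Rightarrow> (nat set \<Rightarrow> nat) \<Rightarrow> bool" where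
  "has_rainbow_triangle n c \<longleftrightarrow>
     (\<exists>x<n. \<exists>y<n. \<exists>z<n. distinct [x, y, z] \<and> distinct [c {x, y}, c {y, z}, c {x, z}])"

definition diag_ramsey_number :: "'a sgraph \<Rightarrow> nat" where
  "diag_ramsey_number H =
     (LEAST n. \<forall>c. c \<in> nsets {..<n} 2 \<rightarrow> {..<2} \<longrightarrow> has_mono_copy H n c)"

(* Colorings must use all k colors, so the required property holds vacuously for small n
   (K_n may have fewer than k edges) and is not monotone in n.  The number is therefore the
   least threshold n from which on the property holds for every K_N with N \<ge> n. *)

definition gallai_ramsey_number :: "nat \<Rightarrow> 'a sgraph \<Rightarrow> nat" where
  "gallai_ramsey_number k H =
     (LEAST n. \<forall>N\<ge>n. \<forall>c. c ` nsets {..<N} 2 = {..<k} \<longrightarrow>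
        has_rainbow_triangle N c \<or> has_mono_copy H N c)"

end

theory Submission
  imports Defs
begin

text \<open>
  Lower bound: to an extremal two-colouring append pairs of vertices, the \<open>i\<close>-th pair being joined
  to everything before it in a new colour. A new colour class is covered by two vertices, whereas
  \<open>K_{3,m}\<close> contains a matching of size 3.

  Upper bound: in a Gallai colouring without monochromatic \<open>K_{3,m}\<close>, take a smallest homogeneous
  set \<open>W\<close> (every outside vertex sees it in one colour) with at least \<open>m\<close> elements. At most two
  outside vertices see \<open>W\<close> in any given colour, so it suffices to bound \<open>W\<close> together with the
  vertices attached to it in the two colours \<open>r\<close>, \<open>b\<close> of its Gallai partition. By minimality all
  parts have fewer than \<open>m\<close> elements; a part of size at least 3 makes \<open>W\<close> smaller than \<open>3m\<close>. So
  the edges of \<open>W\<close> in other colours form a matching. Two attached vertices of colour \<open>r\<close> bound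
  the \<open>r\<close>-degrees in \<open>W\<close> by \<open>m - 1\<close>, making \<open>b\<close> too dense. Otherwise \<open>W\<close> and its attached
  vertices form a set in which every edge outside colours \<open>r\<close>, \<open>b\<close> belongs to a matching; a matched
  pair is a pair of twins, which is impossible in a set of size \<open>6m - 2\<close>, and without
  matched pairs Ramsey's theorem applies.
\<close>

section \<open>Monochromatic copies of \<open>K_{3,m}\<close> as pairs of vertex sets\<close>

text \<open>The colouring is a curried \<open>d\<close> on an arbitrary vertex type, so one notion
  serves both \<open>{..<n}\<close> and abstract vertex sets. Disjoint sides keep the arbitrary
  values \<open>d x x\<close> out.\<close>

definition mono_K3 :: "('a \<Rightarrow> 'a \<Rightarrow> nat) \<Rightarrow> 'a set \<Rightarrow> nat \<Rightarrow> nat \<Rightarrow> bool" where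
  "mono_K3 d V m i \<longleftrightarrow> (\<exists>X Y. X \<subseteq> V \<and> Y \<subseteq> V \<and> X \<inter> Y = {} \<and> card X = 3 \<and> card Y = m \<and>
     (\<forall>x\<in>X. \<forall>y\<in>Y. d x y = i))"

lemma mono_K3I:
  assumes "X \<subseteq> V" "Y \<subseteq> V" "X \<inter> Y = {}" "3 \<le> card X" "m \<le> card Y"
    and "\<And>x y. x \<in> X \<Longrightarrow> y \<in> Y \<Longrightarrow> d x y = i"
  shows "mono_K3 d V m i"
proof -
  obtain X' where X': "X' \<subseteq> X" "card X' = 3" using assms(4) by (meson obtain_subset_with_card_n)
  obtain Y' where Y': "Y' \<subseteq> Y" "card Y' = m" using assms(5) by (meson obtain_subset_with_card_n)
  have "X' \<inter> Y' = {}" using X'(1) Y'(1) assms(3) by auto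
  moreover have "\<forall>x\<in>X'. \<forall>y\<in>Y'. d x y = i" using X'(1) Y'(1) assms(6) by auto
  moreover have "X' \<subseteq> V" "Y' \<subseteq> V" using X'(1) Y'(1) assms(1,2) by auto
  ultimately show ?thesis unfolding mono_K3_def using X'(2) Y'(2) by blast
qed

lemma mono_K3_mono:
  assumes "mono_K3 d W m i" "W \<subseteq> V"
  shows "mono_K3 d V m i"
proof -
  obtain X Y where "X \<subseteq> W" "Y \<subseteq> W" "X \<inter> Y = {}" "card X = 3" "card Y = m"
    "\<forall>x\<in>X. \<forall>y\<in>Y. d x y = i"
    using assms(1) unfolding mono_K3_def by blast
  then show ?thesis using assms(2) by (intro mono_K3I[of X V Y]) auto
qed

text \<open>The images of the two sides under an embedding serve as \<open>X\<close> and
  \<open>Y\<close>. Conversely, enumerations of \<open>X\<close> and \<open>Y\<close> glue to an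
  embedding, injective because the sides are disjoint.\<close>

lemma has_mono_copy_K3_iff:
  "has_mono_copy (complete_bipartite 3 m) n c \<longleftrightarrow>
     (\<exists>i. mono_K3 (\<lambda>x y. c {x, y}) {..<n} m i)"
proof
  assume "has_mono_copy (complete_bipartite 3 m) n c"
  then obtain f i where f0: "inj_on f ({..<3::nat} <+> {..<m})"
      "f ` ({..<3::nat} <+> {..<m}) \<subseteq> {..<n}"
      and e: "\<forall>e\<in>{{Inl a, Inr b} |a b. a < (3::nat) \<and> b < m}. c (f ` e) = i"
    unfolding has_mono_copy_def complete_bipartite_def fst_conv snd_conv by (elim exE conjE)
  have "c (f ` {Inl a, Inr b}) = i" if "a < (3::nat)" "b < m" for a b
    using e that by blast
  note f = f0 this
  have injX: "inj_on f (Inl ` {..<3::nat})" and injY: "inj_on f (Inr ` {..<m})"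
    using f(1) by (auto elim!: inj_on_subset)
  show "\<exists>i. mono_K3 (\<lambda>x y. c {x, y}) {..<n} m i" unfolding mono_K3_def
  proof (intro exI conjI)
    show "card (f ` Inl ` {..<3::nat}) = 3" using injX by (simp add: card_image)
    show "card (f ` Inr ` {..<m}) = m" using injY by (simp add: card_image)
    show "f ` Inl ` {..<3::nat} \<subseteq> {..<n}" "f ` Inr ` {..<m} \<subseteq> {..<n}" using f(2) by auto
    show "f ` Inl ` {..<3::nat} \<inter> f ` Inr ` {..<m} = {}"
      using f(1) by (auto simp: inj_on_def)
    show "\<forall>x\<in>f ` Inl ` {..<3::nat}. \<forall>y\<in>f ` Inr ` {..<m}. c {x, y} = i"
      using f(3) by auto
  qed
next
  assume "\<exists>i. mono_K3 (\<lambda>x y. c {x, y}) {..<n} m i"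
  then obtain i X Y where XY: "X \<subseteq> {..<n}" "Y \<subseteq> {..<n}" "X \<inter> Y = {}" "card X = 3" "card Y = m"
     "\<forall>x\<in>X. \<forall>y\<in>Y. c {x, y} = i"
    unfolding mono_K3_def by auto
  have "finite X" "finite Y" using XY finite_subset by blast+
  then obtain g h where g: "bij_betw g {..<3::nat} X" and h: "bij_betw h {..<m} Y"
    using XY by (metis ex_bij_betw_nat_finite atLeast0LessThan)
  have mem: "\<And>a. a < 3 \<Longrightarrow> g a \<in> X" "\<And>b. b < m \<Longrightarrow> h b \<in> Y"
    using g h by (auto simp: bij_betw_def)
  have "inj_on (case_sum g h) ({..<3::nat} <+> {..<m})"
  proof (rule inj_onI)
    fix u v
    assume uv: "u \<in> {..<3::nat} <+> {..<m}" "v \<in> {..<3::nat} <+> {..<m}"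
      and eq: "case_sum g h u = case_sum g h v"
    have disj: "g a \<noteq> h b" if "a < 3" "b < m" for a b using mem(1)[OF that(1)] mem(2)[OF that(2)] XY(3) by auto
    show "u = v"
    proof (cases u; cases v)
      fix a b assume "u = Inl a" "v = Inl b"
      then show ?thesis using uv eq g by (auto simp: bij_betw_def inj_on_def)
    next
      fix a b assume "u = Inl a" "v = Inr b"
      then show ?thesis using uv eq disj by auto
    next
      fix a b assume "u = Inr a" "v = Inl b"
      then show ?thesis using uv eq disj[of b a] by auto
    next
      fix a b assume "u = Inr a" "v = Inr b"
      then show ?thesis using uv eq h by (auto simp: bij_betw_def inj_on_def)
    qed
  qed
  moreover have "case_sum g h ` ({..<3::nat} <+> {..<m}) \<subseteq> {..<n}"
    using subsetD[OF XY(1) mem(1)] subsetD[OF XY(2) mem(2)] by auto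
  moreover have "\<forall>e\<in>{{Inl a, Inr b} |a b. a < 3 \<and> b < m}. c (case_sum g h ` e) = i"
    using XY(6) mem by auto
  ultimately show "has_mono_copy (complete_bipartite 3 m) n c"
    unfolding has_mono_copy_def complete_bipartite_def fst_conv snd_conv by blast
qed

section \<open>Gallai colourings, components of the other colours, and Gallai's cut\<close>

locale gallai_coloring =
  fixes d :: "'a \<Rightarrow> 'a \<Rightarrow> nat" and V :: "'a set"
  assumes finV: "finite V"
    and sym: "d x y = d y x"
    and tri: "\<lbrakk>x \<in> V; y \<in> V; z \<in> V; x \<noteq> y; y \<noteq> z; x \<noteq> z\<rbrakk>
      \<Longrightarrow> d x y = d y z \<or> d y z = d x z \<or> d x y = d x z"
begin

definition other_edges :: "nat \<Rightarrow> nat \<Rightarrow> 'a set \<Rightarrow> 'a rel" where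
  "other_edges r b W = {(x, y). x \<in> W \<and> y \<in> W \<and> x \<noteq> y \<and> d x y \<notin> {r, b}}"

text \<open>Connected components of the graph on \<open>W\<close> whose edges have neither colour
  \<open>r\<close> nor \<open>b\<close>. They are the parts of the Gallai partition once some cut of
  \<open>W\<close> uses only these two colours.\<close>

definition component :: "nat \<Rightarrow> nat \<Rightarrow> 'a set \<Rightarrow> 'a \<Rightarrow> 'a set" where
  "component r b W x = (other_edges r b W)\<^sup>* `` {x}"

lemma component_refl: "x \<in> component r b W x"
  by (simp add: component_def)

lemma component_sym: "y \<in> component r b W x \<Longrightarrow> x \<in> component r b W y"
proof -
  have "Relation.sym (other_edges r b W)" by (auto simp: Relation.sym_def other_edges_def sym)
  then show "y \<in> component r b W x \<Longrightarrow> x \<in> component r b W y"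
    unfolding component_def by (auto dest: sym_rtrancl symD)
qed

lemma component_trans: "y \<in> component r b W x \<Longrightarrow> z \<in> component r b W y \<Longrightarrow> z \<in> component r b W x"
  by (auto simp: component_def)

lemma component_closed:
  assumes "y \<in> component r b W x" "x \<in> S"
    and "\<And>u v. (u, v) \<in> other_edges r b W \<Longrightarrow> u \<in> S \<Longrightarrow> v \<in> S"
  shows "y \<in> S"
proof -
  have "(x, y) \<in> (other_edges r b W)\<^sup>*" using assms(1) by (simp add: component_def)
  then show ?thesis by (induction rule: rtrancl_induct) (use assms in auto)
qed

lemma component_subset: "x \<in> W \<Longrightarrow> component r b W x \<subseteq> W"
  using component_closed[of _ r b W x W] by (auto simp: other_edges_def)

lemma component_outside:
  assumes "x \<in> W" "w \<in> W" "w \<notin> component r b W x" "y \<in> component r b W x"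
  shows "d w y \<in> {r, b}"
proof (rule ccontr)
  assume "d w y \<notin> {r, b}"
  moreover have "w \<noteq> y" "y \<in> W" using assms component_subset[OF assms(1)] by auto
  ultimately have "(y, w) \<in> other_edges r b W" using assms by (auto simp: other_edges_def sym)
  then have "w \<in> component r b W x" using assms(4) by (auto simp: component_def)
  then show False using assms by simp
qed

text \<open>Walk from \<open>x\<close> to \<open>y\<close> along edges of other colours. Each such
  edge spans with \<open>w\<close> a triangle whose two remaining edges have colours in
  \<open>{r, b}\<close>; as it is not rainbow, these two agree.\<close>

lemma component_module:
  assumes "W \<subseteq> V" "x \<in> W" "w \<in> W" "w \<notin> component r b W x" "y \<in> component r b W x"
  shows "d w y = d w x"
proof -
  have "(x, y) \<in> (other_edges r b W)\<^sup>*" using assms(5) by (simp add: component_def)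
  then show ?thesis
  proof (induction rule: rtrancl_induct)
    case (step y z)
    have yz: "y \<in> W" "z \<in> W" "y \<noteq> z" "d y z \<notin> {r, b}" using step by (auto simp: other_edges_def)
    have mem: "y \<in> component r b W x" "z \<in> component r b W x" using step by (auto simp: component_def)
    then have "d w y \<in> {r, b}" "d w z \<in> {r, b}" using component_outside assms by blast+
    moreover have "w \<noteq> y" "w \<noteq> z" using mem assms by auto
    ultimately have "d w y = d w z" using tri[of w y z] yz assms(1,3) by (metis subsetD)
    then show ?case using step by simp
  qed simp
qed

text \<open>One colour joins any two parts: by \<open>component_module\<close> each endpoint moves
  freely inside its part while the other is fixed.\<close>

lemma component_module2:
  assumes "W \<subseteq> V" "x \<in> W" "y \<in> W" "y \<notin> component r b W x" "x' \<in> component r b W x" "y' \<in> component r b W y"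
  shows "d x' y' = d x y"
proof -
  have "d y x' = d y x" using component_module assms by blast
  moreover have "x' \<notin> component r b W y" using assms component_sym component_trans by meson
  then have "d x' y' = d x' y" using component_module assms component_subset by (metis subsetD)
  ultimately show ?thesis by (simp add: sym)
qed

text \<open>
  Gallai's theorem as a cut: induction on the vertex set. If the new vertex \<open>x\<close> sees every
  component of the other colours through an edge of a third colour, all these edges have the same
  colour \<open>g\<close>, and \<open>x\<close> sees at most one more colour, so \<open>{x}\<close> is the new cut.
\<close>

theorem gallai_cut:
  assumes "W \<subseteq> V" "2 \<le> card W" "2 \<le> card K"
    and "\<And>x y. x \<in> W \<Longrightarrow> y \<in> W \<Longrightarrow> x \<noteq> y \<Longrightarrow> d x y \<in> K"
  shows "\<exists>r\<in>K. \<exists>b\<in>K. r \<noteq> b \<and> (\<exists>S. S \<subset> W \<and> S \<noteq> {} \<and> (\<forall>x\<in>S. \<forall>y\<in>W - S. d x y \<in> {r, b}))"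
proof -
  have "finite W" using assms(1) finV finite_subset by blast
  then show ?thesis using assms(1,2,4)
  proof (induction W rule: finite_induct)
    case (insert x W)
    note col = insert.prems(3)
    have xV: "x \<in> V" and WV: "W \<subseteq> V" using insert.prems by auto
    show ?case
    proof (cases "card W = 1")
      case True
      then obtain y where W: "W = {y}" by (auto simp: card_1_singleton_iff)
      have dK: "d x y \<in> K" and xy: "x \<noteq> y" using col[of x y] insert W by auto
      obtain b where b: "b \<in> K" "b \<noteq> d x y"
        using assms(3) dK by (metis card_le_Suc0_iff_eq card.infinite not_less_eq_eq numeral_2_eq_2
            not_numeral_le_zero)
      show ?thesis using dK b W xy
        by (intro bexI[of _ "d x y"] bexI[of _ b] conjI exI[of _ "{x}"]) auto
    next
      case False
      then have "2 \<le> card W" using insert by simp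
      from insert.IH[OF WV this] col obtain r b S where rb: "r \<in> K" "b \<in> K" "r \<noteq> b"
        and S: "S \<subset> W" "S \<noteq> {}" "\<forall>x\<in>S. \<forall>y\<in>W - S. d x y \<in> {r, b}" by auto
      let ?C = "component r b W"
      \<comment> \<open>\<open>S\<close> and \<open>W - S\<close> are both closed under
        \<open>other_edges\<close>, so each component lies on one side of the cut and misses the
        other, nonempty side.\<close>
      have other: "\<exists>w\<in>W. w \<notin> ?C y" if "y \<in> W" for y
      proof -
        have cl: "\<And>u v. (u, v) \<in> other_edges r b W \<Longrightarrow> u \<in> S \<Longrightarrow> v \<in> S"
          "\<And>u v. (u, v) \<in> other_edges r b W \<Longrightarrow> u \<in> W - S \<Longrightarrow> v \<in> W - S"
          using S(3) unfolding other_edges_def by (blast, metis (no_types, lifting) DiffE DiffI case_prodD mem_Collect_eq sym)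
        show ?thesis
        proof (cases "y \<in> S")
          case True
          then show ?thesis using component_closed[of _ r b W y S] cl(1) S(1) by blast
        next
          case False
          then show ?thesis using component_closed[of _ r b W y "W - S"] cl(2) S(1,2) that by blast
        qed
      qed
      show ?thesis
      proof (cases "\<exists>y\<in>W. \<forall>z\<in>?C y. d x z \<in> {r, b}")
        case True
        \<comment> \<open>A component that \<open>x\<close> sees only in \<open>r\<close> and
          \<open>b\<close> remains one side of a cut after \<open>x\<close> is added.\<close>
        then obtain y where y: "y \<in> W" "\<forall>z\<in>?C y. d x z \<in> {r, b}" by auto
        have "?C y \<subset> insert x W" using component_subset[OF y(1)] insert.hyps by blast
        moreover have "?C y \<noteq> {}" using component_refl by blast
        moreover have "\<forall>u\<in>?C y. \<forall>v\<in>insert x W - ?C y. d u v \<in> {r, b}"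
          using y component_outside[OF y(1)] sym by (metis Diff_iff insert_iff)
        ultimately show ?thesis using rb by blast
      next
        case False
        then have hit: "\<exists>z\<in>?C y. d x z \<notin> {r, b}" if "y \<in> W" for y using that by auto
        have xne: "x \<noteq> y" if "y \<in> W" for y using that insert.hyps by auto
        have far: "d x y = d x z" if "y \<in> W" "z \<in> W" "z \<notin> ?C y" "d x y \<notin> {r, b}" "d x z \<notin> {r, b}"
          for y z
        proof -
          have "d z y \<in> {r, b}" "z \<noteq> y" using component_outside that component_refl by metis+
          then show ?thesis using tri[of x y z] xV subsetD[OF WV] that xne[of y] xne[of z] sym[of y z] by auto
        qed
        have same: "d x y = d x z"
          if yz: "y \<in> W" "z \<in> W" "d x y \<notin> {r, b}" "d x z \<notin> {r, b}" for y z
        proof (cases "z \<in> ?C y")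
          case True
          \<comment> \<open>For \<open>y\<close> and \<open>z\<close> in the same component,
            \<open>far\<close> compares both with a vertex of another component that
            \<open>x\<close> sees in a third colour.\<close>
          obtain w where w: "w \<in> W" "w \<notin> ?C y" using other yz by blast
          obtain w' where w': "w' \<in> ?C w" "d x w' \<notin> {r, b}" using hit w by blast
          have "w' \<in> W" using w' component_subset w by blast
          moreover have "w' \<notin> ?C y" "w' \<notin> ?C z" using w w' True component_sym component_trans by meson+
          ultimately show ?thesis using far[of y w'] far[of z w'] yz w' by auto
        qed (use far that in auto)
        obtain y0 where y0: "y0 \<in> W" using \<open>2 \<le> card W\<close> by fastforce
        obtain y1 where y1: "y1 \<in> ?C y0" "d x y1 \<notin> {r, b}" using hit y0 by blast
        then have y1W: "y1 \<in> W" using component_subset y0 by blast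
        define g where "g = d x y1"
        have g: "g \<notin> {r, b}" "g \<in> K"
          using y1 y1W col[of x y1] xne[OF y1W] by (simp_all add: g_def)
        have cols: "d x y \<in> {r, b, g}" if "y \<in> W" for y
          using same[OF that y1W _ y1(2)] unfolding g_def by blast
        have not_both: False if z: "z \<in> W" "d x z = r" and z': "z' \<in> W" "d x z' = b" for z z'
        proof -
          have ne: "u \<noteq> v" if "v \<notin> ?C u" for u v using that component_refl by metis
          \<comment> \<open>In the triangle \<open>x\<close>, \<open>y\<close>, \<open>u\<close>
            only \<open>d x y\<close> lies outside \<open>{r, b}\<close>, so the other two edges
            share their colour.\<close>
          have near: "d y u = d x u"
            if u: "u \<in> W" "y \<in> W" "u \<notin> ?C y" "d x y \<notin> {r, b}" "d x u \<in> {r, b}" for u y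
          proof -
            have "d u y \<in> {r, b}" using component_outside u component_refl by metis
            then have "d y u \<in> {r, b}" by (simp add: sym)
            then show ?thesis using tri[of x y u] xV subsetD[OF WV] u xne[of y] xne[of u] ne[OF u(3)] by auto
          qed
          show False
          proof (cases "z' \<in> ?C z")
            case True
            \<comment> \<open>A vertex \<open>w'\<close> of another component copies the colours in
              which \<open>x\<close> sees \<open>z\<close> and \<open>z'\<close>, but it must see
              their common component in one colour.\<close>
            obtain w where w: "w \<in> W" "w \<notin> ?C z" using other z by blast
            obtain w' where w': "w' \<in> ?C w" "d x w' \<notin> {r, b}" using hit w by blast
            have w'W: "w' \<in> W" using w' component_subset w by blast
            have nin: "w' \<notin> ?C z" "z \<notin> ?C w'" "z' \<notin> ?C w'"
              using w w' True component_sym component_trans by meson+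
            have "d w' z = r" "d w' z' = b" using near nin w' w'W z z' by auto
            moreover have "d w' z' = d w' z" using component_module[OF WV z(1) w'W nin(1) True] .
            ultimately show False using rb by simp
          next
            case False
            \<comment> \<open>The single colour between the two components is \<open>b\<close> when
              read off at \<open>y\<close> and \<open>z'\<close>, and \<open>r\<close> when read off
              at \<open>y'\<close> and \<open>z\<close>.\<close>
            obtain y where y: "y \<in> ?C z" "d x y \<notin> {r, b}" using hit z by blast
            obtain y' where y': "y' \<in> ?C z'" "d x y' \<notin> {r, b}" using hit z' by blast
            have W: "y \<in> W" "y' \<in> W" using y y' component_subset z z' by blast+
            have nin: "z' \<notin> ?C y" "z \<notin> ?C y'" using False y y' component_sym component_trans by meson+
            have "d y z' = b" "d y' z = r" using near nin W y y' z z' by auto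
            moreover have "d y z' = d z z'"
              using component_module2[OF WV z(1) z'(1) False y(1) component_refl] .
            moreover have "d z y' = d z z'"
              using component_module2[OF WV z(1) z'(1) False component_refl y'(1)] .
            ultimately show False using rb by (simp add: sym)
          qed
        qed
        obtain r' where r': "r' \<in> {r, b}" "\<forall>y\<in>W. d x y \<in> {r', g}"
          using not_both cols by (metis empty_iff insert_iff)
        have "r' \<in> K" "r' \<noteq> g" using r'(1) g(1) rb by auto
        moreover have "{x} \<subset> insert x W" using y0 insert.hyps by blast
        moreover have "\<forall>u\<in>{x}. \<forall>v\<in>insert x W - {x}. d u v \<in> {r', g}" using r'(2) by simp
        moreover have "{x} \<noteq> {}" by simp
        ultimately show ?thesis using g(2) by blast
      qed
    qed
  qed simp
qed

section \<open>Degree conditions that force a monochromatic \<open>K_{3,m}\<close>\<close>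

text \<open>Closed non-neighbourhood of \<open>x\<close> in colour \<open>i\<close>. The vertex
  \<open>x\<close> is put in explicitly because \<open>d x x\<close> is arbitrary.\<close>

definition nonnb :: "nat \<Rightarrow> 'a \<Rightarrow> 'a set \<Rightarrow> 'a set" where
  "nonnb i x S = {y \<in> S. y = x \<or> d x y \<noteq> i}"

text \<open>The vertices of \<open>S\<close> outside the union are common neighbours of
  \<open>x\<close>, \<open>y\<close>, \<open>z\<close> and distinct from them. The three vertices
  may themselves lie outside \<open>S\<close>.\<close>

lemma mono_K3_three:
  assumes "S \<subseteq> V" "x \<in> V" "y \<in> V" "z \<in> V" "distinct [x, y, z]"
    and "card (nonnb i x S \<union> nonnb i y S \<union> nonnb i z S) + m \<le> card S"
  shows "mono_K3 d V m i"
proof (rule mono_K3I)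
  let ?U = "nonnb i x S \<union> nonnb i y S \<union> nonnb i z S"
  have "?U \<subseteq> S" by (auto simp: nonnb_def)
  moreover have "finite S" using assms(1) finV finite_subset by blast
  ultimately have "card (S - ?U) = card S - card ?U" by (meson card_Diff_subset finite_subset)
  then show "m \<le> card (S - ?U)" using assms(6) by simp
  show "S - ?U \<subseteq> V" "{x, y, z} \<subseteq> V" using assms by auto
  show "3 \<le> card {x, y, z}" using assms by simp
qed (auto simp: nonnb_def)

text \<open>Two suitable vertices have at most 2m vertices in the union of their closed
  non-neighbourhoods, and a third adds at most m + 1. At least (6m - 5) - (3m + 1) = 3m - 6 \<ge> m
  common neighbours remain.\<close>

lemma mono_K3_dense:
  assumes S: "S \<subseteq> V" "6 * m \<le> card S + 5" and m: "3 \<le> m"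
    and deg: "\<And>x. x \<in> S \<Longrightarrow> card (nonnb i x S) \<le> m + 1"
  shows "mono_K3 d V m i"
proof -
  have finS: "finite S" using S finV finite_subset by blast
  have fin: "finite (nonnb i x S)" for x using finS by (simp add: nonnb_def)
  \<comment> \<open>The closed non-neighbourhoods of two vertices joined in another colour overlap in both.\<close>
  have "\<exists>x\<in>S. \<exists>y\<in>S. x \<noteq> y \<and> card (nonnb i x S \<union> nonnb i y S) \<le> 2 * m"
  proof (cases "\<exists>x\<in>S. \<exists>y\<in>S. x \<noteq> y \<and> d x y \<noteq> i")
    case True
    then obtain x y where xy: "x \<in> S" "y \<in> S" "x \<noteq> y" "d x y \<noteq> i" by auto
    have "{x, y} \<subseteq> nonnb i x S \<inter> nonnb i y S" using xy by (auto simp: nonnb_def sym)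
    then have "2 \<le> card (nonnb i x S \<inter> nonnb i y S)"
      using card_mono[of "nonnb i x S \<inter> nonnb i y S" "{x, y}"] fin xy(3) by simp
    then have "card (nonnb i x S \<union> nonnb i y S) \<le> 2 * m"
      using deg[OF xy(1)] deg[OF xy(2)] card_Un_Int[OF fin[of x] fin[of y]] by linarith
    then show ?thesis using xy by blast
  next
    case False
    have "2 \<le> card S" using S m by simp
    then obtain x y where xy: "x \<in> S" "y \<in> S" "x \<noteq> y"
      by (metis card_le_Suc0_iff_eq finS not_less_eq_eq numeral_2_eq_2)
    then have "nonnb i x S \<union> nonnb i y S \<subseteq> {x, y}" using False by (auto simp: nonnb_def)
    then have "card (nonnb i x S \<union> nonnb i y S) \<le> card {x, y}" by (intro card_mono) auto
    also have "card {x, y} = 2" using xy by simp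
    finally have "card (nonnb i x S \<union> nonnb i y S) \<le> 2 * m" using m by linarith
    then show ?thesis using xy by blast
  qed
  then obtain x y where xy: "x \<in> S" "y \<in> S" "x \<noteq> y"
    "card (nonnb i x S \<union> nonnb i y S) \<le> 2 * m" by auto
  have "\<not> S \<subseteq> {x, y}"
  proof
    assume "S \<subseteq> {x, y}"
    then have "card S \<le> card {x, y}" by (intro card_mono) auto
    then show False using S m xy by simp
  qed
  then obtain z where z: "z \<in> S" "z \<noteq> x" "z \<noteq> y" by auto
  have "card (nonnb i x S \<union> nonnb i y S \<union> nonnb i z S) \<le> 2 * m + (m + 1)"
    using xy(4) deg[OF z(1)] card_Un_le[of "nonnb i x S \<union> nonnb i y S" "nonnb i z S"] by linarith
  then show ?thesis using S m xy z by (intro mono_K3_three[of S x y z]) auto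
qed


text \<open>Otherwise \<open>u\<close>, \<open>v\<close>, \<open>z\<close> form the side of size 3,
  and neighbours of \<open>z\<close> in \<open>T\<close> the other side.\<close>

lemma twin_degree:
  assumes "\<not> mono_K3 d V m i" "T \<subseteq> V" "u \<in> V" "v \<in> V" "u \<noteq> v" "u \<notin> T" "v \<notin> T"
    and uv: "\<And>t. t \<in> T \<Longrightarrow> d u t = i" "\<And>t. t \<in> T \<Longrightarrow> d v t = i"
    and "z \<in> V" "z \<noteq> u" "z \<noteq> v"
  shows "card {y \<in> T. y \<noteq> z \<and> d z y = i} < m"
proof (rule ccontr)
  assume "\<not> ?thesis"
  then have "mono_K3 d V m i"
    using assms by (intro mono_K3I[of "{u, v, z}" V "{y \<in> T. y \<noteq> z \<and> d z y = i}"]) auto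
  then show False using assms by simp
qed

text \<open>The vertex itself, at most m - 1 neighbours in colour \<open>r\<close> and at most one
  in a further colour add up to m + 1.\<close>

lemma nonnb_card:
  assumes "finite S" "card {y \<in> S. y \<noteq> x \<and> d x y = r} < m"
    and "card {y \<in> S. y \<noteq> x \<and> d x y \<notin> {r, b}} \<le> 1"
  shows "card (nonnb b x S) \<le> m + 1"
proof -
  let ?R = "{y \<in> S. y \<noteq> x \<and> d x y = r}" and ?G = "{y \<in> S. y \<noteq> x \<and> d x y \<notin> {r, b}}"
  have "nonnb b x S \<subseteq> insert x (?R \<union> ?G)" by (auto simp: nonnb_def)
  then have "card (nonnb b x S) \<le> card (insert x (?R \<union> ?G))"
    using assms(1) by (intro card_mono) auto
  also have "\<dots> \<le> Suc (card (?R \<union> ?G))" by (simp add: card_insert_if assms(1))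
  also have "\<dots> \<le> Suc (card ?R + card ?G)" using card_Un_le by simp
  finally show ?thesis using assms(2,3) by linarith
qed

section \<open>Sets in which the edges outside two colours form a matching\<close>

definition matched :: "nat \<Rightarrow> nat \<Rightarrow> 'a set \<Rightarrow> bool" where
  "matched r b Z \<longleftrightarrow> (\<forall>x\<in>Z. \<forall>y\<in>Z. \<forall>z\<in>Z. x \<noteq> y \<longrightarrow> x \<noteq> z \<longrightarrow>
     d x y \<notin> {r, b} \<longrightarrow> d x z \<notin> {r, b} \<longrightarrow> y = z)"

lemma matchedD:
  "matched r b Z \<Longrightarrow> x \<in> Z \<Longrightarrow> y \<in> Z \<Longrightarrow> z \<in> Z \<Longrightarrow> x \<noteq> y \<Longrightarrow> x \<noteq> z \<Longrightarrow>
     d x y \<notin> {r, b} \<Longrightarrow> d x z \<notin> {r, b} \<Longrightarrow> y = z"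
  unfolding matched_def by (drule bspec, assumption, drule bspec, assumption, drule bspec, assumption, simp)

lemma matched_commute: "matched r b Z = matched b r Z"
  by (simp add: matched_def insert_commute)

lemma matched_card:
  assumes "matched r b Z" "x \<in> Z" "S \<subseteq> Z"
  shows "card {y \<in> S. y \<noteq> x \<and> d x y \<notin> {r, b}} \<le> 1"
proof (cases "{y \<in> S. y \<noteq> x \<and> d x y \<notin> {r, b}} = {}")
  case False
  then obtain y where y: "y \<in> S" "y \<noteq> x" "d x y \<notin> {r, b}" by blast
  have "{y \<in> S. y \<noteq> x \<and> d x y \<notin> {r, b}} \<subseteq> {y}"
    using matchedD[OF assms(1,2) _ _ _ _ y(3)] y(1,2) subsetD[OF assms(3)] by blast
  then have "card {y \<in> S. y \<noteq> x \<and> d x y \<notin> {r, b}} \<le> card {y}" by (intro card_mono) auto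
  then show ?thesis by simp
next
  case True
  then show ?thesis by (metis (no_types) card.empty zero_le)
qed

text \<open>The edge \<open>p q\<close> uses up the matching at both ends, so \<open>z\<close> sees
  \<open>p\<close> and \<open>q\<close> in \<open>r\<close> or \<open>b\<close>; the triangle
  \<open>p\<close>, \<open>q\<close>, \<open>z\<close> then forces equal colours.\<close>

lemma matched_twin:
  assumes "matched r b Z" "Z \<subseteq> V" and pq: "p \<in> Z" "q \<in> Z" "p \<noteq> q" "d p q \<notin> {r, b}"
    and z: "z \<in> Z - {p, q}"
  shows "d p z \<in> {r, b}" "d q z = d p z"
proof -
  have "d q p \<notin> {r, b}" using assms(6) by (simp add: sym)
  then have *: "d p z \<in> {r, b}" "d q z \<in> {r, b}"
    using matchedD[OF assms(1) pq(1,2), of z] matchedD[OF assms(1) pq(2,1), of z] pq(3,4) z by blast+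
  then show "d p z \<in> {r, b}" by simp
  show "d q z = d p z"
    using tri[of p q z] * assms(3-7) subsetD[OF assms(2)] by auto
qed

text \<open>All pairs of \<open>A\<close> and \<open>B\<close> are covered by the
  \<open>P\<close>-pairs, counted from \<open>A\<close>, and the \<open>Q\<close>-pairs, counted
  from \<open>B\<close>.\<close>

lemma double_count:
  assumes "finite A" "finite B" "\<And>x y. x \<in> A \<Longrightarrow> y \<in> B \<Longrightarrow> P x y \<or> Q x y"
    and "\<And>x. x \<in> A \<Longrightarrow> card {y \<in> B. P x y} \<le> k" "\<And>y. y \<in> B \<Longrightarrow> card {x \<in> A. Q x y} \<le> l"
  shows "card A * card B \<le> card A * k + card B * l"
proof -
  have "A \<times> B \<subseteq> (SIGMA x:A. {y \<in> B. P x y}) \<union> prod.swap ` (SIGMA y:B. {x \<in> A. Q x y})"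
    using assms(3) by force
  then have "card (A \<times> B) \<le>
      card ((SIGMA x:A. {y \<in> B. P x y}) \<union> prod.swap ` (SIGMA y:B. {x \<in> A. Q x y}))"
    using assms(1,2) by (intro card_mono) auto
  also have "\<dots> \<le> card (SIGMA x:A. {y \<in> B. P x y}) + card (SIGMA y:B. {x \<in> A. Q x y})"
    using card_Un_le[of "SIGMA x:A. {y \<in> B. P x y}" "prod.swap ` (SIGMA y:B. {x \<in> A. Q x y})"]
      card_image_le[of "SIGMA y:B. {x \<in> A. Q x y}" prod.swap] assms(1,2) by simp
  also have "\<dots> = (\<Sum>x\<in>A. card {y \<in> B. P x y}) + (\<Sum>y\<in>B. card {x \<in> A. Q x y})"
    using assms(1,2) by (simp add: card_SigmaI)
  also have "\<dots> \<le> card A * k + card B * l"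
    using sum_bounded_above[of A "\<lambda>x. card {y \<in> B. P x y}" k] assms(4)
      sum_bounded_above[of B "\<lambda>y. card {x \<in> A. Q x y}" l] assms(5) by (simp add: add_mono)
  finally show ?thesis by (simp add: card_cartesian_product)
qed

text \<open>The twins \<open>p\<close>, \<open>q\<close> split the rest of \<open>Z\<close> into
  common \<open>r\<close>-neighbours \<open>A\<close> and common \<open>b\<close>-neighbours
  \<open>B\<close>, and by \<open>twin_degree\<close> they bound the \<open>r\<close>-degrees into
  \<open>A\<close> and the \<open>b\<close>-degrees into \<open>B\<close>. Hence \<open>b\<close> is
  dense towards \<open>A\<close>, and a case split on the size of \<open>B\<close> ends in a
  contradiction. The hypothesis \<open>le\<close> is the choice between \<open>r\<close> and
  \<open>b\<close> made by symmetry.\<close>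

lemma matched_twins_impossible_aux:
  assumes mat: "matched r b Z" and Z: "Z \<subseteq> V" "6 * m \<le> card Z + 2" and m: "3 \<le> m"
    and free: "\<not> mono_K3 d V m r" "\<not> mono_K3 d V m b" and rb: "r \<noteq> b"
    and pq: "p \<in> Z" "q \<in> Z" "p \<noteq> q" "d p q \<notin> {r, b}"
    and le: "card {z \<in> Z - {p, q}. d p z = b} \<le> card {z \<in> Z - {p, q}. d p z = r}"
  shows False
proof -
  define A where "A = {z \<in> Z - {p, q}. d p z = r}"
  define B where "B = {z \<in> Z - {p, q}. d p z = b}"
  note twin = matched_twin[OF mat Z(1) pq]
  have finZ: "finite Z" using Z(1) finV finite_subset by blast
  have finAB: "finite A" "finite B" using finZ by (auto simp: A_def B_def)
  have AZ: "A \<subseteq> Z" and BZ: "B \<subseteq> Z" and AV: "A \<subseteq> V" and BV: "B \<subseteq> V"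
    using Z(1) by (auto simp: A_def B_def)
  have "A \<union> B = Z - {p, q}" "A \<inter> B = {}" using twin(1) rb by (auto simp: A_def B_def)
  then have "card A + card B = card Z - 2"
    using card_Un_disjoint[OF finAB] finZ pq by (simp add: card_Diff_subset)
  moreover have "2 \<le> card Z" using Z(2) m by linarith
  ultimately have cAB: "6 * m \<le> card A + card B + 4" using Z(2) by linarith
  have leAB: "card B \<le> card A" using le by (simp add: A_def B_def)
  have degr: "card {y \<in> A. y \<noteq> z \<and> d z y = r} < m" if "z \<in> Z - {p, q}" for z
    using pq Z(1) that twin AV
    by (intro twin_degree[OF free(1), of A p q z]) (auto simp: A_def)
  have degb: "card {y \<in> B. y \<noteq> z \<and> d z y = b} < m" if "z \<in> Z - {p, q}" for z
    using pq Z(1) that twin BV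
    by (intro twin_degree[OF free(2), of B p q z]) (auto simp: B_def)
  have nA: "card (nonnb b x A) \<le> m + 1" if "x \<in> A" for x
    using that AZ by (intro nonnb_card[OF finAB(1) degr matched_card[OF mat _ AZ]]) (auto simp: A_def)
  \<comment> \<open>\<open>p\<close> sees \<open>x\<close> in \<open>b\<close> and \<open>y\<close>
    in \<open>r\<close>, so a third colour on \<open>x y\<close> would give a rainbow triangle. Thus
    \<open>nB\<close> beats \<open>nA\<close> by two: neither \<open>x\<close> itself nor a matching
    partner counts.\<close>
  have cross: "d x y \<in> {r, b}" if x: "x \<in> B" and y: "y \<in> A" for x y
  proof -
    have "d p x = b" "d p y = r" "x \<noteq> y" "x \<noteq> p" "y \<noteq> p"
      using x y rb by (auto simp: A_def B_def)
    then show ?thesis using tri[of p x y] pq subsetD[OF Z(1)] x y subsetD[OF AV y] subsetD[OF BV x] rb by auto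
  qed
  have nB: "card (nonnb b x A) \<le> m - 1" if x: "x \<in> B" for x
  proof -
    have "nonnb b x A \<subseteq> {y \<in> A. y \<noteq> x \<and> d x y = r}"
      using cross[OF x] x rb by (auto simp: nonnb_def A_def B_def)
    then have "card (nonnb b x A) \<le> card {y \<in> A. y \<noteq> x \<and> d x y = r}"
      using finAB by (intro card_mono) auto
    moreover have "\<dots> < m" using degr x by (simp add: B_def)
    ultimately show ?thesis by linarith
  qed
  have no3: "card A < card (nonnb b x A) + card (nonnb b y A) + card (nonnb b z A) + m"
    if "distinct [x, y, z]" "{x, y, z} \<subseteq> A \<union> B" for x y z
  proof (rule ccontr)
    assume "\<not> ?thesis"
    then have "card (nonnb b x A \<union> nonnb b y A \<union> nonnb b z A) + m \<le> card A"
      using card_Un_le[of "nonnb b x A \<union> nonnb b y A" "nonnb b z A"]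
        card_Un_le[of "nonnb b x A" "nonnb b y A"] by linarith
    then have "mono_K3 d V m b"
      using that AV BV by (intro mono_K3_three[of A x y z]) auto
    then show False using free by simp
  qed
  consider "card B \<le> 1" | "card B = 2" | "3 \<le> card B" by linarith
  then show False
  proof cases
    case 1
    then have "mono_K3 d V m b" using cAB m nA by (intro mono_K3_dense[OF AV]) auto
    then show False using free by simp
  next
    case 2
    then obtain x y where xy: "B = {x, y}" "x \<noteq> y" by (auto simp: card_2_iff)
    have "0 < card A" using leAB 2 by linarith
    then obtain z where z: "z \<in> A" by (auto simp: card_gt_0_iff)
    \<comment> \<open>The two vertices of \<open>B\<close> and one of \<open>A\<close> give card A <
      2(m - 1) + (m + 1) + m = 4m - 1, whereas card A \<ge> 6m - 6.\<close>
    have "distinct [x, y, z]" "{x, y, z} \<subseteq> A \<union> B" using xy z rb by (auto simp: A_def B_def)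
    from no3[OF this] show False using nB[of x] nB[of y] nA[OF z] xy cAB 2 m by auto
  next
    case 3
    then obtain T where "T \<subseteq> B" "card T = 3" by (meson obtain_subset_with_card_n)
    then obtain x y z where xyz: "x \<in> B" "y \<in> B" "z \<in> B" "distinct [x, y, z]"
      by (auto simp: card_3_iff)
    then have "card A < 3 * (m - 1) + m"
      using no3[of x y z] nB[OF xyz(1)] nB[OF xyz(2)] nB[OF xyz(3)] by auto
    then have B2: "2 * m \<le> card B" using cAB m by linarith
    \<comment> \<open>An edge between \<open>A\<close> and \<open>B\<close> is a
      \<open>b\<close>-edge, of which each vertex of \<open>A\<close> has at most m - 1, or an
      \<open>r\<close>-edge, of which each vertex of \<open>B\<close> has at most m - 1. With 2m
      \<le> card B \<le> card A this is too few.\<close>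
    have "card A * card B \<le> card A * (m - 1) + card B * (m - 1)"
    proof (rule double_count[OF finAB])
      show "d x y = b \<or> d y x = r" if "x \<in> A" "y \<in> B" for x y
        using cross[OF that(2,1)] by (auto simp: sym)
      show "card {y \<in> B. d x y = b} \<le> m - 1" if "x \<in> A" for x
      proof -
        have "{y \<in> B. d x y = b} = {y \<in> B. y \<noteq> x \<and> d x y = b}"
          using that rb by (auto simp: A_def B_def)
        then show ?thesis using degb[of x] that by (simp add: A_def)
      qed
      show "card {x \<in> A. d y x = r} \<le> m - 1" if "y \<in> B" for y
      proof -
        have "{x \<in> A. d y x = r} = {x \<in> A. x \<noteq> y \<and> d y x = r}"
          using that rb by (auto simp: A_def B_def)
        then show ?thesis using degr[of y] that by (simp add: B_def)
      qed
    qed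
    also have "\<dots> \<le> card A * (m - 1) + card A * (m - 1)" using leAB by simp
    also have "\<dots> = card A * (2 * (m - 1))" by simp
    also have "\<dots> < card A * (2 * m)" using B2 leAB m by simp
    also have "\<dots> \<le> card A * card B" using B2 by simp
    finally show False by simp
  qed
qed

lemma matched_twins_impossible:
  assumes mat: "matched r b Z" and Z: "Z \<subseteq> V" "6 * m \<le> card Z + 2" and m: "3 \<le> m"
    and free: "\<not> mono_K3 d V m r" "\<not> mono_K3 d V m b" and rb: "r \<noteq> b"
    and pq: "p \<in> Z" "q \<in> Z" "p \<noteq> q" "d p q \<notin> {r, b}"
  shows False
proof (cases "card {z \<in> Z - {p, q}. d p z = b} \<le> card {z \<in> Z - {p, q}. d p z = r}")
  case True
  then show False using matched_twins_impossible_aux[OF assms] by simp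
next
  case False
  have "matched b r Z" "d p q \<notin> {b, r}" using mat pq(4) by (auto simp: matched_commute)
  then show False
    using matched_twins_impossible_aux[of b r Z m p q] Z m free rb pq(1-3) False by simp
qed


section \<open>Homogeneous sets and the size of a Gallai colouring without
  \<open>K_{3,m}\<close>\<close>

text \<open>Known as a module of the edge-coloured graph; the colour \<open>i\<close> may depend on
  the outside vertex.\<close>

definition homogeneous :: "'a set \<Rightarrow> bool" where
  "homogeneous W \<longleftrightarrow> W \<subseteq> V \<and> (\<forall>v\<in>V - W. \<exists>i. \<forall>w\<in>W. d v w = i)"

text \<open>Vertices of \<open>W\<close> outside the component see it in one colour by
  \<open>component_module\<close>; vertices outside \<open>W\<close> see even all of
  \<open>W\<close> in one colour.\<close>

lemma component_homogeneous:
  assumes W: "homogeneous W" and x: "x \<in> W"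
  shows "homogeneous (component r b W x)"
  unfolding homogeneous_def
proof (intro conjI ballI)
  have WV: "W \<subseteq> V" using W by (simp add: homogeneous_def)
  then show "component r b W x \<subseteq> V" using component_subset[OF x, of r b] by auto
  fix v assume v: "v \<in> V - component r b W x"
  show "\<exists>i. \<forall>w\<in>component r b W x. d v w = i"
  proof (cases "v \<in> W")
    case True
    then show ?thesis using component_module[OF WV x True] v by auto
  next
    case False
    then obtain i where "\<forall>w\<in>W. d v w = i" using W v unfolding homogeneous_def by blast
    then show ?thesis using component_subset[OF x, of r b] by auto
  qed
qed

text \<open>For nonempty \<open>W\<close> different colours give disjoint sets; for empty
  \<open>W\<close> each of them is all of \<open>V\<close>.\<close>

definition attached :: "'a set \<Rightarrow> nat \<Rightarrow> 'a set" where
  "attached W i = {v \<in> V - W. \<forall>w\<in>W. d v w = i}"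

lemma attachedD:
  assumes "v \<in> attached W i"
  shows "v \<in> V" "v \<notin> W" "\<And>w. w \<in> W \<Longrightarrow> d v w = i"
  using assms by (auto simp: attached_def)

lemma finite_attached [simp]: "finite (attached W i)"
  using finV by (simp add: attached_def)

lemma card_attached_le:
  assumes "W \<subseteq> V" "m \<le> card W" "\<not> mono_K3 d V m i"
  shows "card (attached W i) \<le> 2"
proof (rule ccontr)
  assume "\<not> ?thesis"
  then have "mono_K3 d V m i"
    using assms(1,2) by (intro mono_K3I[of "attached W i" V W]) (auto simp: attached_def)
  then show False using assms(3) by simp
qed

text \<open>Every outside vertex is attached in some colour of \<open>K\<close>, and each colour
  besides \<open>r\<close> and \<open>b\<close> contributes at most two vertices. The sets for
  \<open>r\<close> and \<open>b\<close> stay explicit because the later case analysis depends on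
  their sizes.\<close>

lemma card_le_homogeneous:
  assumes W: "homogeneous W" "W \<noteq> {}" "m \<le> card W" and K: "finite K" "r \<in> K" "b \<in> K" "r \<noteq> b"
    and col: "\<And>x y. x \<in> V \<Longrightarrow> y \<in> V \<Longrightarrow> x \<noteq> y \<Longrightarrow> d x y \<in> K"
    and free: "\<And>i. \<not> mono_K3 d V m i"
  shows "card V \<le> card W + card (attached W r) + card (attached W b) + 2 * (card K - 2)"
proof -
  have WV: "W \<subseteq> V" and finW: "finite W"
    using W(1) finV finite_subset by (auto simp: homogeneous_def)
  have att: "card (attached W i) \<le> 2" for i using card_attached_le[OF WV W(3) free] .
  have "V \<subseteq> W \<union> (\<Union>i\<in>K. attached W i)"
  proof
    fix v assume v: "v \<in> V"
    show "v \<in> W \<union> (\<Union>i\<in>K. attached W i)"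
    proof (cases "v \<in> W")
      case False
      then obtain i where i: "\<forall>w\<in>W. d v w = i"
        using W(1) v unfolding homogeneous_def by blast
      obtain w where w: "w \<in> W" using W(2) by auto
      have "i \<in> K" using col[of v w] i w v False WV by auto
      then show ?thesis using i v False by (auto simp: attached_def)
    qed simp
  qed
  then have "card V \<le> card (W \<union> (\<Union>i\<in>K. attached W i))"
    using finW K(1) by (intro card_mono) auto
  also have "\<dots> \<le> card W + (\<Sum>i\<in>K. card (attached W i))"
    using card_Un_le[of W "\<Union>i\<in>K. attached W i"] card_UN_le[OF K(1), of "attached W"] by linarith
  also have "(\<Sum>i\<in>K. card (attached W i)) =
      card (attached W r) + (card (attached W b) + (\<Sum>i\<in>K - {r} - {b}. card (attached W i)))"
    using K by (simp add: sum.remove[of K r] sum.remove[of "K - {r}" b])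
  also have "(\<Sum>i\<in>K - {r} - {b}. card (attached W i)) \<le> card (K - {r} - {b}) * 2"
    using sum_bounded_above[of "K - {r} - {b}" "\<lambda>i. card (attached W i)" 2] att by simp
  also have "card (K - {r} - {b}) = card K - 2" using K by simp
  finally show ?thesis by simp
qed

text \<open>All that is known of \<open>R\<close> is \<open>ram\<close>. It is applied once, to
  \<open>W\<close> with its attached vertices in colours \<open>r\<close> and \<open>b\<close>,
  after other colours have been excluded there.\<close>

theorem card_gallai_less:
  assumes m: "3 \<le> m" and K: "finite K" "2 \<le> card K"
    and col: "\<And>x y. x \<in> V \<Longrightarrow> y \<in> V \<Longrightarrow> x \<noteq> y \<Longrightarrow> d x y \<in> K"
    and free: "\<And>i. \<not> mono_K3 d V m i"
    and ram: "\<And>Z r b. Z \<subseteq> V \<Longrightarrow> r \<noteq> b \<Longrightarrow>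
      (\<And>x y. x \<in> Z \<Longrightarrow> y \<in> Z \<Longrightarrow> x \<noteq> y \<Longrightarrow> d x y \<in> {r, b}) \<Longrightarrow> card Z < R"
  shows "card V < max (6 * m - 2) R + 2 * (card K - 2)"
proof (rule ccontr)
  assume "\<not> ?thesis"
  then have big: "6 * m + 2 * (card K - 2) \<le> card V + 2" "R + 2 * (card K - 2) \<le> card V"
    by auto
  have "homogeneous V" by (simp add: homogeneous_def)
  moreover have "m \<le> card V" using big(1) by linarith
  ultimately obtain W where W: "homogeneous W" "m \<le> card W"
    and least: "\<And>W'. homogeneous W' \<Longrightarrow> m \<le> card W' \<Longrightarrow> card W \<le> card W'"
    using ex_has_least_nat[of "\<lambda>W. homogeneous W \<and> m \<le> card W" V card] by blast
  have WV: "W \<subseteq> V" using W(1) by (simp add: homogeneous_def)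
  have finW: "finite W" using WV finV finite_subset by blast
  have Wne: "W \<noteq> {}" using W(2) m by auto
  have "\<exists>r\<in>K. \<exists>b\<in>K. r \<noteq> b \<and> (\<exists>S. S \<subset> W \<and> S \<noteq> {} \<and> (\<forall>x\<in>S. \<forall>y\<in>W - S. d x y \<in> {r, b}))"
    using W(2) m K WV col by (intro gallai_cut) auto
  then obtain r b S where rb: "r \<in> K" "b \<in> K" "r \<noteq> b"
    and S: "S \<subset> W" "S \<noteq> {}" "\<And>x y. x \<in> S \<Longrightarrow> y \<in> W - S \<Longrightarrow> d x y \<in> {r, b}" by blast
  let ?C = "component r b W"
  have total: "6 * m \<le> card W + card (attached W r) + card (attached W b) + 2"
    "R \<le> card W + card (attached W r) + card (attached W b)"
    using card_le_homogeneous[OF W(1) Wne W(2) K(1) rb col free] big by linarith+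
  have att2: "card (attached W i) \<le> 2" for i using card_attached_le[OF WV W(2) free] .
  \<comment> \<open>The two attached sets take at most four of the 6m - 2 vertices.\<close>
  have W6: "6 * m \<le> card W + 6" using total(1) att2[of r] att2[of b] by linarith
  have C_proper: "?C x \<subset> W" if x: "x \<in> W" for x
  proof -
    have cl: "v \<in> S" if "(u, v) \<in> other_edges r b W" "u \<in> S" for u v
      using S(3)[of u v] that by (auto simp: other_edges_def)
    have cl': "v \<in> W - S" if "(u, v) \<in> other_edges r b W" "u \<in> W - S" for u v
      using S(3)[of v u] that by (auto simp: other_edges_def sym[of u v])
    have "?C x \<noteq> W"
    proof (cases "x \<in> S")
      case True
      then have "?C x \<subseteq> S" using component_closed[of _ r b W x S] cl by blast
      then show ?thesis using S(1) by auto
    next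
      case False
      then have "?C x \<subseteq> W - S" using component_closed[of _ r b W x "W - S"] cl' x by blast
      then show ?thesis using S(1,2) by auto
    qed
    then show ?thesis using component_subset[OF x, of r b] by auto
  qed
  have C_small: "card (?C x) < m" if x: "x \<in> W" for x
    using least[OF component_homogeneous[OF W(1) x, of r b]] psubset_card_mono[OF finW C_proper[OF x]]
    by linarith
  have C_le2: "card (?C x) \<le> 2" if x: "x \<in> W" for x
  proof (rule ccontr)
    assume "\<not> ?thesis"
    then have C3: "3 \<le> card (?C x)" by simp
    \<comment> \<open>The part contains at least three vertices, all joined to \<open>A i\<close> in
      colour \<open>i\<close>, so \<open>A i\<close> has fewer than \<open>m\<close> elements.
      Together with the part this gives card W \<le> 3(m - 1) < 6m - 6.\<close>
    define A where "A i = {w \<in> W - ?C x. d w x = i}" for i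
    have A: "card (A i) < m" for i
    proof (rule ccontr)
      assume "\<not> ?thesis"
      then have "m \<le> card (A i)" by simp
      moreover have "d y w = i" if "y \<in> ?C x" "w \<in> A i" for y w
        using component_module[OF WV x, of w r b y] that by (auto simp: A_def sym[of y w])
      moreover have "?C x \<subseteq> V" "A i \<subseteq> V" "?C x \<inter> A i = {}"
        using C_proper[OF x] WV by (auto simp: A_def)
      ultimately have "mono_K3 d V m i" using C3 by (intro mono_K3I[of "?C x" V "A i"])
      then show False using free by simp
    qed
    have "d w x \<in> {r, b}" if "w \<in> W - ?C x" for w
      using component_outside[OF x, of w r b x] that component_refl by simp
    then have "W \<subseteq> ?C x \<union> (A r \<union> A b)" by (auto simp: A_def)
    moreover have "finite (?C x)" using C_proper[OF x] finW finite_subset by blast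
    ultimately have "card W \<le> card (?C x \<union> (A r \<union> A b))"
      using finW by (intro card_mono) (auto simp: A_def)
    also have "\<dots> \<le> card (?C x) + (card (A r) + card (A b))"
      using card_Un_le[of "?C x" "A r \<union> A b"] card_Un_le[of "A r" "A b"] by linarith
    finally show False using C_small[OF x] A[of r] A[of b] W6 m by linarith
  qed
  have mat: "matched r b W"
    unfolding matched_def
  proof (intro ballI impI, rule ccontr)
    fix x y z
    assume xyz: "x \<in> W" "y \<in> W" "z \<in> W" "x \<noteq> y" "x \<noteq> z"
      and ne: "d x y \<notin> {r, b}" "d x z \<notin> {r, b}" "y \<noteq> z"
    have "(x, y) \<in> other_edges r b W" "(x, z) \<in> other_edges r b W"
      using xyz ne by (simp_all add: other_edges_def)
    then have "{x, y, z} \<subseteq> ?C x" by (auto simp: component_def)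
    moreover have "finite (?C x)" using C_proper[OF xyz(1)] finW finite_subset by blast
    ultimately have "card {x, y, z} \<le> card (?C x)" by (simp add: card_mono)
    then show False using C_le2[OF xyz(1)] xyz ne(3) by simp
  qed
  have deg: "card {y \<in> W. y \<noteq> w \<and> d w y = i} < m" if two: "card (attached W i) = 2" and w: "w \<in> W" for i w
  proof -
    obtain u v where uv: "attached W i = {u, v}" "u \<noteq> v" using two by (auto simp: card_2_iff)
    have *: "u \<in> attached W i" "v \<in> attached W i" using uv(1) by auto
    show ?thesis
    proof (rule twin_degree[OF free WV _ _ uv(2)])
      show "w \<in> V" using w WV by auto
      show "w \<noteq> u" "w \<noteq> v" using w attachedD(2)[OF *(1)] attachedD(2)[OF *(2)] by auto
    qed (use attachedD[OF *(1)] attachedD[OF *(2)] in auto)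
  qed
  \<comment> \<open>Degrees in colour \<open>i\<close> are at most m - 1 and the remaining colours
    form a matching, so colour \<open>j\<close> is dense. The size 6m - 5 is what is left of 6m - 2
    after attached sets of sizes two and at most one.\<close>
  have one_sided: False
    if ij: "matched i j W" "card (attached W i) = 2" "6 * m \<le> card W + 5" for i j
  proof -
    have "mono_K3 d V m j"
      using nonnb_card[OF finW deg[OF ij(2)] matched_card[OF ij(1)]] ij(3) m
      by (intro mono_K3_dense[OF WV]) auto
    then show False using free by simp
  qed
  consider "card (attached W r) = 2" "card (attached W b) = 2"
    | "card (attached W r) = 2" "card (attached W b) \<le> 1"
    | "card (attached W r) \<le> 1" "card (attached W b) = 2"
    | "card (attached W r) \<le> 1" "card (attached W b) \<le> 1"
    using att2[of r] att2[of b] by linarith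
  then show False
  proof cases
    case 1
    \<comment> \<open>Degrees in both colours are at most m - 1, so \<open>w\<close>, its neighbours
      and at most one partner give card W \<le> 2m < 6m - 6.\<close>
    obtain w where w: "w \<in> W" using Wne by auto
    let ?N = "\<lambda>i. {y \<in> W. y \<noteq> w \<and> d w y = i}"
    have "W - nonnb b w W \<subseteq> ?N b" by (auto simp: nonnb_def)
    then have "card (W - nonnb b w W) \<le> card (?N b)" using finW by (intro card_mono) auto
    moreover have "card (nonnb b w W) \<le> m + 1"
      using nonnb_card[OF finW deg[OF 1(1) w] matched_card[OF mat w]] by simp
    moreover have "card (W - nonnb b w W) = card W - card (nonnb b w W)"
      using finW by (intro card_Diff_subset) (auto simp: nonnb_def)
    ultimately show False using deg[OF 1(2) w] W6 m by linarith
  next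
    case 2
    then show False using one_sided[OF mat] total(1) by linarith
  next
    case 3
    then show False using one_sided[of b r] mat total(1) matched_commute[of r b W] by linarith
  next
    case 4
    define Z where "Z = W \<union> attached W r \<union> attached W b"
    have ZV: "Z \<subseteq> V" using WV by (auto simp: Z_def attached_def)
    have "(W \<union> attached W r) \<inter> attached W b = {}"
      using Wne rb(3) by (auto simp: attached_def)
    then have "card Z = card (W \<union> attached W r) + card (attached W b)"
      unfolding Z_def using finW by (intro card_Un_disjoint) simp_all
    also have "card (W \<union> attached W r) = card W + card (attached W r)"
      using finW attachedD(2) by (intro card_Un_disjoint) auto
    finally have cZ: "6 * m \<le> card Z + 2" "R \<le> card Z" using total by auto
    have eq: "u = v" if "u \<in> attached W i" "v \<in> attached W i" "i \<in> {r, b}" for u v i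
      using that 4 by (auto simp: card_le_Suc0_iff_eq)
    obtain w where w: "w \<in> W" using Wne by auto
    \<comment> \<open>Distinct attached vertices have different colours towards \<open>W\<close>,
      since each attached set has at most one element; the triangle with \<open>w\<close> then
      leaves only \<open>r\<close> and \<open>b\<close> between them.\<close>
    have Zrb: "d u z \<in> {r, b}" if u: "u \<in> Z - W" and z: "z \<in> Z" "u \<noteq> z" for u z
    proof -
      obtain i where i: "i \<in> {r, b}" "u \<in> attached W i" using u by (auto simp: Z_def)
      show ?thesis
      proof (cases "z \<in> W")
        case True
        then show ?thesis using attachedD(3)[OF i(2)] i(1) by auto
      next
        case False
        then obtain j where j: "j \<in> {r, b}" "z \<in> attached W j" using z by (auto simp: Z_def)
        have "i \<noteq> j" using eq i j z(2) by auto
        moreover have "d u w = i" "d z w = j"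
          using attachedD(3)[OF i(2) w] attachedD(3)[OF j(2) w] by auto
        moreover have "u \<in> V" "z \<in> V" "w \<in> V" "u \<noteq> w" "z \<noteq> w"
          using attachedD[OF i(2)] attachedD[OF j(2)] w WV by auto
        ultimately show ?thesis using tri[of u z w] z(2) i(1) j(1) by auto
      qed
    qed
    have inW: "x \<in> W \<and> y \<in> W" if "x \<in> Z" "y \<in> Z" "x \<noteq> y" "d x y \<notin> {r, b}" for x y
      using Zrb[of x y] Zrb[of y x] that sym[of x y] by auto
    have matZ: "matched r b Z"
      unfolding matched_def
    proof (intro ballI impI)
      fix x y z assume *: "x \<in> Z" "y \<in> Z" "z \<in> Z" "x \<noteq> y" "x \<noteq> z" "d x y \<notin> {r, b}" "d x z \<notin> {r, b}"
      then show "y = z" using matchedD[OF mat _ _ _ *(4-7)] inW[OF *(1,2,4,6)] inW[OF *(1,3,5,7)] by simp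
    qed
    \<comment> \<open>An exception would be a matched pair of twins in a set of at least 6m - 2
      vertices.\<close>
    have "d x y \<in> {r, b}" if "x \<in> Z" "y \<in> Z" "x \<noteq> y" for x y
      using matched_twins_impossible[OF matZ ZV cZ(1) m free free rb(3) that] by blast
    then have "card Z < R" using ram[OF ZV rb(3)] by blast
    then show False using cZ(2) by simp
  qed
qed

end


section \<open>The two-colour Ramsey property and the upper bound for \<open>{..<N}\<close>\<close>

definition ramsey_K3 :: "nat \<Rightarrow> nat \<Rightarrow> bool" where
  "ramsey_K3 m n \<longleftrightarrow>
     (\<forall>c. c \<in> nsets {..<n} 2 \<rightarrow> {..<2} \<longrightarrow> has_mono_copy (complete_bipartite 3 m) n c)"

text \<open>Ramsey's theorem gives a monochromatic clique on m + 3 vertices, which contains both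
  sides. Existence makes the \<open>LEAST\<close> in the Ramsey number meaningful.\<close>

lemma ramsey_K3_ex: "\<exists>n. ramsey_K3 m n"
proof -
  obtain n :: nat where n: "partn_lst {..<n} [m + 3, m + 3] 2" using ramsey_full by blast
  have "has_mono_copy (complete_bipartite 3 m) n c" if c: "c \<in> nsets {..<n} 2 \<rightarrow> {..<2}" for c
  proof -
    obtain i H where H: "H \<in> nsets {..<n} (m + 3)" "c ` nsets H 2 \<subseteq> {i}"
    proof -
      have two: "length [m + 3, m + 3] = 2" by simp
      obtain i where i: "i < 2" "monochromatic {..<n} ([m + 3, m + 3] ! i) 2 c i"
        using n c unfolding partn_lst_def two by blast
      then have "[m + 3, m + 3] ! i = m + 3" by (auto simp: less_2_cases_iff)
      then show ?thesis using i(2) that unfolding monochromatic_def by auto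
    qed
    then have Hn: "H \<subseteq> {..<n}" "finite H" "card H = m + 3" by (auto simp: nsets_def)
    obtain X where X: "X \<subseteq> H" "card X = 3" by (metis Hn(3) le_add2 obtain_subset_with_card_n)
    have "card (H - X) = m" using X Hn by (simp add: card_Diff_subset finite_subset)
    moreover have "c {x, y} = i" if "x \<in> X" "y \<in> H - X" for x y
    proof -
      have "{x, y} \<in> nsets H 2" using that X(1) by auto
      then show ?thesis using H(2) by blast
    qed
    ultimately have "mono_K3 (\<lambda>x y. c {x, y}) {..<n} m i"
      using X Hn(1) by (intro mono_K3I[of X _ "H - X"]) auto
    then show ?thesis using has_mono_copy_K3_iff by blast
  qed
  then show ?thesis unfolding ramsey_K3_def by blast
qed

text \<open>Number \<open>n\<close> vertices of \<open>Z\<close> by \<open>h\<close> and recode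
  \<open>r\<close> as 0 and \<open>b\<close> as 1; a monochromatic copy on \<open>{..<n}\<close> is
  carried back by \<open>h\<close>.\<close>

lemma ramsey_K3_transfer:
  fixes d :: "'a \<Rightarrow> 'a \<Rightarrow> nat"
  assumes R: "ramsey_K3 m n" and Z: "finite Z" "n \<le> card Z" and m: "1 \<le> m"
    and sym: "\<And>x y. d x y = d y x" and rb: "r \<noteq> b"
    and col: "\<And>x y. x \<in> Z \<Longrightarrow> y \<in> Z \<Longrightarrow> x \<noteq> y \<Longrightarrow> d x y \<in> {r, b}"
  shows "\<exists>i. mono_K3 d Z m i"
proof -
  obtain Z' where Z': "Z' \<subseteq> Z" "card Z' = n" using Z(2) by (meson obtain_subset_with_card_n)
  then obtain h where h: "bij_betw h {..<n} Z'"
    using Z(1) finite_subset ex_bij_betw_nat_finite[of Z'] by (auto simp: atLeast0LessThan)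
  have hZ: "h x \<in> Z" if "x < n" for x using h Z'(1) that by (auto simp: bij_betw_def)
  have hinj: "inj_on h {..<n}" using h by (simp add: bij_betw_def)
  \<comment> \<open>\<open>Min\<close> and \<open>Max\<close> recover the ends of an edge; their
    order is irrelevant since \<open>d\<close> is symmetric.\<close>
  define c where "c e = (if d (h (Min e)) (h (Max e)) = r then 0 else 1 :: nat)" for e
  have c: "c {x, y} = (if d (h x) (h y) = r then 0 else 1)" for x y
    using sym[of "h x" "h y"] by (cases "x \<le> y") (auto simp: c_def min_def max_def)
  have "has_mono_copy (complete_bipartite 3 m) n c"
    using R unfolding ramsey_K3_def by (auto simp: c_def)
  then obtain i X Y where XY: "X \<subseteq> {..<n}" "Y \<subseteq> {..<n}" "X \<inter> Y = {}" "card X = 3" "card Y = m"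
      "\<forall>x\<in>X. \<forall>y\<in>Y. c {x, y} = i"
    unfolding has_mono_copy_K3_iff mono_K3_def by blast
  have "mono_K3 d Z m (if i = 0 then r else b)"
  proof (rule mono_K3I[of "h ` X" _ "h ` Y"])
    show "h ` X \<subseteq> Z" "h ` Y \<subseteq> Z" using XY(1,2) hZ by auto
    show "h ` X \<inter> h ` Y = {}"
      using inj_on_image_Int[OF hinj XY(1,2)] XY(3) by simp
    show "3 \<le> card (h ` X)" "m \<le> card (h ` Y)"
      using XY(4,5) card_image[OF inj_on_subset[OF hinj XY(1)]]
        card_image[OF inj_on_subset[OF hinj XY(2)]] by auto
    fix u v assume "u \<in> h ` X" "v \<in> h ` Y"
    then obtain x y where xy: "u = h x" "v = h y" "x \<in> X" "y \<in> Y" by auto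
    have lt: "x < n" "y < n" "x \<noteq> y" using xy XY(1-3) by auto
    have "h x \<noteq> h y" using inj_onD[OF hinj, of x y] lt by auto
    then have "d (h x) (h y) \<in> {r, b}" using col hZ lt by simp
    then show "d u v = (if i = 0 then r else b)"
      using XY(6) c[of x y] xy by (auto split: if_splits)
  qed
  then show ?thesis by blast
qed

lemma gallai_upper:
  assumes m: "3 \<le> m" and k: "2 \<le> k" and R: "ramsey_K3 m R"
    and N: "max (6 * m - 2) R + 2 * (k - 2) \<le> N"
    and c: "c ` nsets {..<N} 2 = {..<k}" and no: "\<not> has_rainbow_triangle N c"
  shows "has_mono_copy (complete_bipartite 3 m) N c"
proof (rule ccontr)
  assume "\<not> ?thesis"
  then have free: "\<not> mono_K3 (\<lambda>x y. c {x, y}) {..<N} m i" for i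
    using has_mono_copy_K3_iff by blast
  interpret gallai_coloring "\<lambda>x y. c {x, y}" "{..<N}"
  proof
    fix x y z assume "x \<in> {..<N}" "y \<in> {..<N}" "z \<in> {..<N}" "x \<noteq> y" "y \<noteq> z" "x \<noteq> z"
    then show "c {x, y} = c {y, z} \<or> c {y, z} = c {x, z} \<or> c {x, y} = c {x, z}"
      using no unfolding has_rainbow_triangle_def by auto
  qed (simp_all add: insert_commute)
  have "card {..<N} < max (6 * m - 2) R + 2 * (card {..<k} - 2)"
  proof (rule card_gallai_less[OF m _ _ _ free])
    show "c {x, y} \<in> {..<k}" if "x \<in> {..<N}" "y \<in> {..<N}" "x \<noteq> y" for x y
      unfolding c[symmetric] using that by (intro imageI) simp
    show "card Z < R"
      if Z: "Z \<subseteq> {..<N}" "r \<noteq> b" "\<And>x y. x \<in> Z \<Longrightarrow> y \<in> Z \<Longrightarrow> x \<noteq> y \<Longrightarrow> c {x, y} \<in> {r, b}" for Z r b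
    proof (rule ccontr)
      assume "\<not> ?thesis"
      then have "\<exists>i. mono_K3 (\<lambda>x y. c {x, y}) Z m i"
        using Z m finite_subset[OF Z(1)]
        by (intro ramsey_K3_transfer[OF R]) (auto simp: insert_commute)
      then show False using free mono_K3_mono[OF _ Z(1)] by blast
    qed
  qed (use k in auto)
  then show False using N by simp
qed

section \<open>The lower bound: extending an extremal two-colouring\<close>

text \<open>Provides the hypothesis \<open>m + 3 \<le> n\<close> of \<open>gallai_lower\<close> when
  \<open>n\<close> is one less than the Ramsey number.\<close>

lemma ramsey_K3_gt:
  assumes m: "3 \<le> m" and R: "ramsey_K3 m n"
  shows "m + 4 \<le> n"
proof (rule ccontr)
  assume "\<not> ?thesis"
  then have n: "n \<le> m + 3" by simp
  \<comment> \<open>A star in one colour and a complete graph on at most \<open>m + 2\<close> vertices in the other.\<close>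
  define c :: "nat set \<Rightarrow> nat" where "c e = (if 0 \<in> e then 0 else 1)" for e
  have "has_mono_copy (complete_bipartite 3 m) n c"
    using R unfolding ramsey_K3_def by (auto simp: c_def)
  then obtain i X Y where XY: "X \<subseteq> {..<n}" "Y \<subseteq> {..<n}" "X \<inter> Y = {}" "card X = 3" "card Y = m"
      "\<forall>x\<in>X. \<forall>y\<in>Y. c {x, y} = i"
    unfolding has_mono_copy_K3_iff mono_K3_def by blast
  have fin: "finite X" "finite Y" using XY(1,2) finite_subset by blast+
  have "\<not> X \<subseteq> {0}" "\<not> Y \<subseteq> {0}"
    using card_mono[of "{0::nat}" X] card_mono[of "{0::nat}" Y] XY(4,5) m by auto
  then obtain x y where xy: "x \<in> X" "x \<noteq> 0" "y \<in> Y" "y \<noteq> 0" by blast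
  then have "i = 1" using XY(6) by (force simp: c_def)
  then have "0 \<notin> X" "0 \<notin> Y" using XY(6) xy by (auto simp: c_def split: if_splits)
  then have "X \<union> Y \<subseteq> {..<n} - {0}" using XY(1,2) by auto
  then have "card (X \<union> Y) \<le> card ({..<n} - {0})" by (intro card_mono) auto
  moreover have "card (X \<union> Y) = m + 3" using card_Un_disjoint[OF fin XY(3)] XY(4,5) by simp
  moreover have "card ({..<n} - {0}) \<le> n - 1" by (cases n) auto
  ultimately show False using n m by linarith
qed

text \<open>Since \<open>m + 3 \<le> n\<close>, a constant colouring would contain
  \<open>K_{3,m}\<close>, so the extremal colouring uses both colours and its extension exactly
  \<open>j + 2\<close>.\<close>

lemma gallai_lower:
  assumes m: "3 \<le> m" and n: "m + 3 \<le> n" and not: "\<not> ramsey_K3 m n"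
  shows "\<exists>c. c ` nsets {..<n + 2 * j} 2 = {..<j + 2} \<and>
     \<not> has_rainbow_triangle (n + 2 * j) c \<and>
     \<not> has_mono_copy (complete_bipartite 3 m) (n + 2 * j) c"
proof -
  let ?N = "n + 2 * j"
  obtain c0 where c0: "c0 \<in> nsets {..<n} 2 \<rightarrow> {..<2}"
    and no: "\<not> has_mono_copy (complete_bipartite 3 m) n c0"
    using not unfolding ramsey_K3_def by blast
  then have free: "\<not> mono_K3 (\<lambda>x y. c0 {x, y}) {..<n} m i" for i
    using has_mono_copy_K3_iff by blast
  \<comment> \<open>The larger end of an edge decides its colour; halving its offset from
    \<open>n\<close> groups the added vertices into pairs.\<close>
  define c where "c e = (if Max e < n then c0 e else 2 + (Max e - n) div 2)" for e
  have c_old: "c {x, y} = c0 {x, y}" if "x < n" "y < n" for x y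
    using that by (auto simp: c_def)
  have c_new: "c {x, y} = 2 + (max x y - n) div 2" if "n \<le> max x y" for x y
    using that by (auto simp: c_def max_def)
  have c0_lt: "c0 {x, y} < 2" if "x < n" "y < n" "x \<noteq> y" for x y
  proof -
    have "{x, y} \<in> nsets {..<n} 2" using that by simp
    then show ?thesis using c0 by auto
  qed
  have both: "\<exists>x<n. \<exists>y<n. x \<noteq> y \<and> c0 {x, y} = i" if i: "i < 2" for i
  proof (rule ccontr)
    assume none: "\<not> ?thesis"
    have eq: "c0 {x, y} = 1 - i" if "x < n" "y < n" "x \<noteq> y" for x y
    proof -
      have "c0 {x, y} \<noteq> i" using none that by blast
      then show ?thesis using c0_lt[OF that] i by linarith
    qed
    have "mono_K3 (\<lambda>x y. c0 {x, y}) {..<n} m (1 - i)"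
    proof (rule mono_K3I[of "{..<3}" _ "{3..<n}"])
      show "c0 {x, y} = 1 - i" if "x \<in> {..<3}" "y \<in> {3..<n}" for x y
        using that n by (intro eq) auto
    qed (use n in auto)
    then show False using free by simp
  qed
  have "c ` nsets {..<?N} 2 = {..<j + 2}"
  proof (intro equalityI subsetI)
    fix i assume "i \<in> c ` nsets {..<?N} 2"
    then obtain x y where xy: "x < ?N" "y < ?N" "x \<noteq> y" "i = c {x, y}"
      by (auto elim!: nsets2_E)
    show "i \<in> {..<j + 2}"
    proof (cases "max x y < n")
      case True
      then show ?thesis using c_old[of x y] c0_lt[of x y] xy by auto
    next
      case False
      then show ?thesis using c_new[of x y] xy by auto
    qed
  next
    fix i assume i: "i \<in> {..<j + 2}"
    have "\<exists>x y. x < ?N \<and> y < ?N \<and> x \<noteq> y \<and> c {x, y} = i"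
    proof (cases "i < 2")
      case True
      then obtain x y where "x < n" "y < n" "x \<noteq> y" "c0 {x, y} = i" using both by blast
      then show ?thesis using c_old[of x y] by (intro exI[of _ x] exI[of _ y]) auto
    next
      case False
      \<comment> \<open>Colour \<open>i\<close> appears between 0 and the first vertex of the pair
        with index \<open>i - 2\<close>.\<close>
      then show ?thesis using i n c_new[of 0 "n + 2 * (i - 2)"]
        by (intro exI[of _ 0] exI[of _ "n + 2 * (i - 2)"]) auto
    qed
    then obtain x y where "x < ?N" "y < ?N" "x \<noteq> y" "c {x, y} = i" by blast
    then show "i \<in> c ` nsets {..<?N} 2" by (intro image_eqI[of _ _ "{x, y}"]) auto
  qed
  moreover have "\<not> has_rainbow_triangle ?N c"
  proof
    assume "has_rainbow_triangle ?N c"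
    then obtain x y z where xyz: "distinct [x, y, z]" "distinct [c {x, y}, c {y, z}, c {x, z}]"
      unfolding has_rainbow_triangle_def by blast
    show False
    proof (cases "x < n \<and> y < n \<and> z < n")
      case True
      then have "c {x, y} < 2" "c {y, z} < 2" "c {x, z} < 2"
        using xyz(1) c0_lt c_old by simp_all
      then show False using xyz(2) by auto
    next
      case False
      \<comment> \<open>The largest vertex of a triangle reaching beyond the first \<open>n\<close>
        vertices sees both others in one colour.\<close>
      have top: "c {u, w} = c {v, w}" if "n \<le> w" "u \<le> w" "v \<le> w" for u v w
        using c_new[of u w] c_new[of v w] that by (simp add: max_def)
      consider "n \<le> x" "y \<le> x" "z \<le> x" | "n \<le> y" "x \<le> y" "z \<le> y" | "n \<le> z" "x \<le> z" "y \<le> z"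
        using False by linarith
      then show False
      proof cases
        case 1
        then have "c {x, y} = c {x, z}" using top[of x y z] by (simp add: insert_commute)
        then show False using xyz(2) by simp
      next
        case 2
        then have "c {x, y} = c {y, z}" using top[of y x z] by (simp add: insert_commute)
        then show False using xyz(2) by simp
      next
        case 3
        then have "c {x, z} = c {y, z}" using top[of z x y] by simp
        then show False using xyz(2) by simp
      qed
    qed
  qed
  moreover have "\<not> has_mono_copy (complete_bipartite 3 m) ?N c"
  proof
    assume "has_mono_copy (complete_bipartite 3 m) ?N c"
    then obtain i X Y where XY: "X \<subseteq> {..<?N}" "Y \<subseteq> {..<?N}" "X \<inter> Y = {}" "card X = 3" "card Y = m"
        and mono: "\<forall>x\<in>X. \<forall>y\<in>Y. c {x, y} = i"
      unfolding has_mono_copy_K3_iff mono_K3_def by blast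
    have ne: "X \<noteq> {}" "Y \<noteq> {}" using XY(4,5) m by auto
    show False
    proof (cases "i < 2")
      case True
      have lt: "x < n \<and> y < n" if "x \<in> X" "y \<in> Y" for x y
      proof -
        have "c {x, y} < 2" using mono that True by simp
        then have "max x y < n" using c_new[of x y] by (cases "n \<le> max x y") (simp, linarith)
        then show ?thesis by simp
      qed
      then have "X \<subseteq> {..<n}" "Y \<subseteq> {..<n}" using ne by blast+
      moreover have "c0 {x, y} = i" if "x \<in> X" "y \<in> Y" for x y
      proof -
        have "c {x, y} = i" using mono that by blast
        then show ?thesis using c_old[of x y] lt[OF that] by simp
      qed
      ultimately have "mono_K3 (\<lambda>x y. c0 {x, y}) {..<n} m i"
        using XY(3-5) by (intro mono_K3I[of X _ Y]) auto
      then show False using free by simp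
    next
      case False
      let ?s = "n + 2 * (i - 2)"
      have hit: "x \<in> {?s, Suc ?s} \<or> y \<in> {?s, Suc ?s}" if xy: "x \<in> X" "y \<in> Y" for x y
      proof -
        have "x \<noteq> y" using xy XY(3) by auto
        have ci: "c {x, y} = i" using mono xy by blast
        have "n \<le> max x y"
        proof (rule ccontr)
          assume "\<not> ?thesis"
          then have "x < n" "y < n" by simp_all
          then show False using c_old[of x y] c0_lt[of x y] \<open>x \<noteq> y\<close> ci False by simp
        qed
        then have "i = 2 + (max x y - n) div 2" using c_new[of x y] ci by simp
        moreover obtain t where t: "max x y = n + t" using \<open>n \<le> max x y\<close> le_Suc_ex by blast
        ultimately have "t div 2 = i - 2" by simp
        then have "t = 2 * (i - 2) \<or> t = Suc (2 * (i - 2))"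
          using div_mult_mod_eq[of t 2] mod_less_divisor[of 2 t] by linarith
        then have "max x y = ?s \<or> max x y = Suc ?s" using t by auto
        then have "max x y \<in> {?s, Suc ?s}" by simp
        then show ?thesis by (auto simp: max_def split: if_splits)
      qed
      have two: "card A \<le> 2" if "A \<subseteq> {?s, Suc ?s}" for A
        using card_mono[OF _ that] by simp
      \<comment> \<open>Some vertex of \<open>X\<close> lies outside the pair, so by
        \<open>hit\<close> all of \<open>Y\<close> lies inside it, although \<open>Y\<close> has at
        least three elements.\<close>
      have "\<not> X \<subseteq> {?s, Suc ?s}" using two[of X] XY(4) by auto
      then have "Y \<subseteq> {?s, Suc ?s}" using hit by blast
      then show False using two[of Y] XY(5) m by auto
    qed
  qed
  ultimately show ?thesis by blast
qed

section \<open>From threshold properties to least numbers\<close>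

theorem theorem15:
  fixes k m :: nat
  assumes "k \<ge> 3" and "m \<ge> 3"
  shows "diag_ramsey_number (complete_bipartite 3 m) + 2 * (k - 2)
           \<le> gallai_ramsey_number k (complete_bipartite 3 m) \<and>
         gallai_ramsey_number k (complete_bipartite 3 m)
           \<le> max (6 * m - 2) (diag_ramsey_number (complete_bipartite 3 m)) + 2 * (k - 2)"
proof -
  define R where "R = diag_ramsey_number (complete_bipartite 3 m)"
  have R_Least: "R = (LEAST n. ramsey_K3 m n)"
    by (simp add: R_def diag_ramsey_number_def ramsey_K3_def)
  have R: "ramsey_K3 m R" using ramsey_K3_ex unfolding R_Least by (rule LeastI_ex)
  have R4: "m + 4 \<le> R" using ramsey_K3_gt[OF assms(2) R] .
  have notR: "\<not> ramsey_K3 m (R - 1)"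
    using not_less_Least[of "R - 1" "ramsey_K3 m"] R4 unfolding R_Least by simp
  define P where "P n \<longleftrightarrow> (\<forall>N\<ge>n. \<forall>c. c ` nsets {..<N} 2 = {..<k} \<longrightarrow>
      has_rainbow_triangle N c \<or> has_mono_copy (complete_bipartite 3 m) N c)" for n
  have G: "gallai_ramsey_number k (complete_bipartite 3 m) = (LEAST n. P n)"
    by (simp add: gallai_ramsey_number_def P_def)
  have upper: "P (max (6 * m - 2) R + 2 * (k - 2))"
    unfolding P_def using gallai_upper[OF assms(2) _ R, of k] assms(1) by simp blast
  have "m + 3 \<le> R - 1" using R4 by linarith
  then obtain c where c: "c ` nsets {..<R - 1 + 2 * (k - 2)} 2 = {..<k - 2 + 2}"
      "\<not> has_rainbow_triangle (R - 1 + 2 * (k - 2)) c"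
      "\<not> has_mono_copy (complete_bipartite 3 m) (R - 1 + 2 * (k - 2)) c"
    using gallai_lower[OF assms(2) _ notR, of "k - 2"] by blast
  have "k - 2 + 2 = k" using assms(1) by simp
  note c = c[unfolded this]
  \<comment> \<open>\<open>P n\<close> speaks of every size from \<open>n\<close> on, so one bad
    colouring on R - 1 + 2(k - 2) vertices refutes \<open>P\<close> at that number and at all
    smaller ones.\<close>
  have "R - 1 + 2 * (k - 2) < n" if "P n" for n
  proof (rule ccontr)
    assume "\<not> ?thesis"
    then show False using that c unfolding P_def by (meson not_less)
  qed
  then have "R - 1 + 2 * (k - 2) < (LEAST n. P n)" using LeastI[of P, OF upper] by blast
  then have "R + 2 * (k - 2) \<le> (LEAST n. P n)" using R4 by linarith
  moreover have "(LEAST n. P n) \<le> max (6 * m - 2) R + 2 * (k - 2)" using upper by (rule Least_le)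
  ultimately show ?thesis using G R_def by simp
qed

end
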